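(* Let $N=\{1,\ldots,n\}$ and let $C \subset \mathbb{R}^n$ be a compact convex set. The following statements are equivalent: (1) $C$ has a least weakly $(a,b)$-supermajorized element for each $a \in \mathbb{R}^n_{>0}$ and $b \in \mathbb{R}^n$; (2) $C$ has a least weakly $(1,b)$-supermajorized element for each $b \in \mathbb{R}^n$; (3) for each $b \in \mathbb{R}^n$, there exists $x^* \in C$ that is an optimal solution to $\min_{x \in C} \Phi(x+b)$ for any choice of non-increasing continuous Schur-convex function $\Phi:\mathbb{R}^n\to\mathbb{R}$; (4) for each permutation $\pi$ of $N$, there exists $x^* \in C$ such that for all $x \in C$ we have $\sum_{i=1}^k x^*_{\pi(i)} \geq \sum_{i=1}^k x_{\pi(i)}$ for all $k \in N$; (5) the function $f(A) := \max_{x \in C} x(A)$, $A\subseteq N$, is submodular and $B(f) \subseteq C \subseteq P(f)$.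
   Context: Notation: $x(A) := \sum_{i\in A} x_i$ for $x\in\mathbb{R}^n$, $A\subseteq N$; in "$(1,b)$", $1$ is the all-ones vector. Weak $(a,b)$-supermajorization: for $a\in\mathbb{R}^n_{>0}$, $b\in\mathbb{R}^n$, $x$ is weakly $(a,b)$-supermajorized by $y$ if $\sum_{i\in N} a_i\phi\left(\frac{x_i+b_i}{a_i}\right)\le \sum_{i\in N} a_i\phi\left(\frac{y_i+b_i}{a_i}\right)$ for all non-increasing continuous convex functions $\phi:\mathbb{R}\to\mathbb{R}$. A vector $x\in C$ is a least weakly $(a,b)$-supermajorized element of $C$ if $x$ is weakly $(a,b)$-supermajorized by every $y\in C$. Schur-convexity: let $x^{\downarrow}$ denote the rearrangement of $x$ in non-increasing order; $x\prec y$ ($x$ is majorized by $y$) if $\sum_{i=1}^k x^{\downarrow}_i\le\sum_{i=1}^k y^{\downarrow}_i$ for all $k\in N$ and $x(N)=y(N)$. $\Phi:\mathbb{R}^n\to\mathbb{R}$ is Schur-convex if $x\prec y$ implies $\Phi(x)\le\Phi(y)$. $\Phi$ is non-increasing if it is non-increasing with respect to the componentwise order. Submodularity: $f:2^N\to\mathbb{R}$ with $f(\emptyset)=0$ is submodular if $f(A)+f(B)\ge f(A\cup B)+f(A\cap B)$ for all $A,B\subseteq N$. $P(f):=\{x\in\mathbb{R}^n : x(A)\le f(A)\ \forall A\subseteq N\}$ and $B(f):=\{x\in P(f): x(N)=f(N)\}$. *)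

theory Defs
  imports "HOL-Analysis.Analysis" "HOL-Library.Multiset"
begin

text \<open>
  The index set \<open>N = {1, \<dots>, n}\<close> is a finite type \<open>'n\<close>, with \<open>n = CARD('n)\<close>.
  As \<open>'n\<close> carries no order, a permutation of \<open>N\<close> is a bijection from
  \<open>{1..CARD('n)}\<close> onto \<open>'n\<close>.
\<close>

definition coord_sum :: "real ^ 'n \<Rightarrow> 'n set \<Rightarrow> real" where
  "coord_sum x A = (\<Sum>i\<in>A. x $ i)"

definition weakly_supermajorized ::
    "real ^ 'n \<Rightarrow> real ^ 'n \<Rightarrow> real ^ 'n \<Rightarrow> real ^ 'n \<Rightarrow> bool" where
  "weakly_supermajorized a b x y \<longleftrightarrow>
     (\<forall>\<phi> :: real \<Rightarrow> real. antimono \<phi> \<and> continuous_on UNIV \<phi> \<and> convex_on UNIV \<phi> \<longrightarrow>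
        (\<Sum>i\<in>UNIV. a $ i * \<phi> ((x $ i + b $ i) / a $ i))
          \<le> (\<Sum>i\<in>UNIV. a $ i * \<phi> ((y $ i + b $ i) / a $ i)))"

definition least_weakly_supermajorized ::
    "(real ^ 'n) set \<Rightarrow> real ^ 'n \<Rightarrow> real ^ 'n \<Rightarrow> real ^ 'n \<Rightarrow> bool" where
  "least_weakly_supermajorized C a b x \<longleftrightarrow>
     x \<in> C \<and> (\<forall>y\<in>C. weakly_supermajorized a b x y)"

text \<open>\<open>decr x i\<close> is the \<open>i\<close>-th largest entry of \<open>x\<close>, for \<open>1 \<le> i \<le> CARD('n)\<close>.\<close>

definition decr :: "real ^ 'n \<Rightarrow> nat \<Rightarrow> real" where
  "decr x i =
     rev (sorted_list_of_multiset (image_mset (($) x) (mset_set UNIV))) ! (i - 1)"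

definition majorized :: "real ^ 'n \<Rightarrow> real ^ 'n \<Rightarrow> bool" where
  "majorized x y \<longleftrightarrow>
     (\<forall>k\<in>{1..CARD('n)}. (\<Sum>i=1..k. decr x i) \<le> (\<Sum>i=1..k. decr y i)) \<and>
     coord_sum x UNIV = coord_sum y UNIV"

definition Schur_convex :: "(real ^ 'n \<Rightarrow> real) \<Rightarrow> bool" where
  "Schur_convex \<Phi> \<longleftrightarrow> (\<forall>x y. majorized x y \<longrightarrow> \<Phi> x \<le> \<Phi> y)"

definition submodular :: "('n set \<Rightarrow> real) \<Rightarrow> bool" where
  "submodular f \<longleftrightarrow>
     f {} = 0 \<and> (\<forall>A B. f A + f B \<ge> f (A \<union> B) + f (A \<inter> B))"

definition submodular_polyhedron :: "('n set \<Rightarrow> real) \<Rightarrow> (real ^ 'n) set" where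
  "submodular_polyhedron f = {x. \<forall>A. coord_sum x A \<le> f A}"

definition base_polyhedron :: "('n set \<Rightarrow> real) \<Rightarrow> (real ^ 'n) set" where
  "base_polyhedron f = {x \<in> submodular_polyhedron f. coord_sum x UNIV = f UNIV}"

text \<open>
  The maximum of \<open>x(A)\<close> over \<open>x \<in> C\<close>, attained if \<open>C\<close> is compact and nonempty.
  For \<open>C = {}\<close> it is an unspecified constant independent of \<open>A\<close>, and then \<open>submodular\<close>
  and \<open>base_polyhedron (support_max C) \<subseteq> C\<close> cannot both hold.
\<close>

definition support_max :: "(real ^ 'n) set \<Rightarrow> 'n set \<Rightarrow> real" where
  "support_max C A = (GREATEST t. t \<in> (\<lambda>x. coord_sum x A) ` C)"

end

(* The first four conditions are linked through truncations s -> max 0 (t - s): these are convex and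
   non-increasing, and comparing their sums gives weak supermajorization, while their sums are
   Schur-convex; with a widely spaced b they read off the partial sums along a permutation.  For
   (4) ==> (5), maximising along a chain through the intersection and the union of A and B gives
   submodularity, and separating a point of the base polyhedron from C contradicts maximality along
   the order of the separating vector.  For (5) ==> (1), let x minimise the sum of
   (x_i + b_i)^2 / a_i over B(f).  By submodularity, the sublevel sets of
   z_i = (x_i + b_i) / a_i are tight for x, and since subgradients of phi at z_i are
   non-positive and monotone, Abel summation over these sublevel sets gives the inequality for
   every y in P(f). *)

theory Submission
  imports Defs
begin

section \<open>Coordinate sums and decreasing rearrangements\<close>

lemma coord_sum_add: "coord_sum (x + y) A = coord_sum x A + coord_sum y A"
  by (simp add: coord_sum_def sum.distrib)

lemma coord_sum_Compl: "coord_sum x A + coord_sum x (- A) = coord_sum x UNIV"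
  using sum.subset_diff[of A UNIV "($) x"] by (simp add: coord_sum_def Compl_eq_Diff_UNIV)

lemma coord_sum_Un_Int:
  "coord_sum x (A \<union> B) + coord_sum x (A \<inter> B) = coord_sum x A + coord_sum x B"
  unfolding coord_sum_def by (simp add: sum.union_inter)

lemma down_closed_eq_atLeastAtMost:
  fixes K :: "nat set"
  assumes "finite K" "0 \<notin> K" and down: "\<And>i j. 1 \<le> i \<Longrightarrow> i \<le> j \<Longrightarrow> j \<in> K \<Longrightarrow> i \<in> K"
  shows "K = {1..card K}"
proof (cases "K = {}")
  case False
  then have "Max K \<in> K" and "\<And>i. i \<in> K \<Longrightarrow> i \<le> Max K"
    using \<open>finite K\<close> by auto
  then have "K = {1..Max K}"
    using down \<open>0 \<notin> K\<close> by (auto simp: Suc_le_eq intro!: gr0I)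
  then show ?thesis
    by (metis card_atLeastAtMost diff_Suc_1)
qed simp

text \<open>Sorting the indices by the key \<open>- (x $ i)\<close>, rather than sorting the values,
  yields a permutation. It replaces the list in \<open>decr\<close>, and also serves merely to list
  the coordinates in the order of a given vector.\<close>

lemma decr_enumeration:
  fixes x :: "real ^ 'n"
  obtains \<pi> :: "nat \<Rightarrow> 'n" where "bij_betw \<pi> {1..CARD('n)} UNIV"
    and "\<And>i. i \<in> {1..CARD('n)} \<Longrightarrow> decr x i = x $ \<pi> i"
    and "\<And>i j. 1 \<le> i \<Longrightarrow> i \<le> j \<Longrightarrow> j \<le> CARD('n) \<Longrightarrow> x $ \<pi> j \<le> x $ \<pi> i"
proof -
  obtain us :: "'n list" where us: "set us = UNIV" "distinct us"
    using finite_distinct_list[OF finite] by blast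
  define ys where "ys = sort_key (\<lambda>i. - (x $ i)) us"
  have ys: "set ys = UNIV" "distinct ys" "mset ys = mset_set UNIV"
    using us by (auto simp: ys_def mset_set_set[symmetric])
  have len: "length ys = CARD('n)"
    using ys by (metis distinct_card)
  have srt: "sorted (map (\<lambda>i. - (x $ i)) ys)"
    by (simp add: ys_def)
  have mono: "x $ (ys ! j) \<le> x $ (ys ! i)" if "i \<le> j" "j < CARD('n)" for i j
    using sorted_nth_mono[OF srt, of i j] that len by simp
  have "sorted (rev (map (($) x) ys))"
    unfolding sorted_rev_iff_nth_mono by (auto simp: len intro: mono)
  then have "sort (map (($) x) ys) = rev (map (($) x) ys)"
    by (intro properties_for_sort) auto
  then have L: "rev (sorted_list_of_multiset (image_mset (($) x) (mset_set UNIV))) = map (($) x) ys"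
    by (simp only: ys(3)[symmetric] mset_map[symmetric] sorted_list_of_multiset_mset rev_rev_ident)
  \<comment> \<open>List positions start at 0, while \<open>decr\<close> and permutations count from
    1.\<close>
  have "bij_betw (\<lambda>i. i - 1) {1..m} {..<m}" for m :: nat
    by (rule bij_betw_byWitness[where f' = Suc]) auto
  moreover have "bij_betw ((!) ys) {..<CARD('n)} UNIV"
    by (rule bij_betw_nth[OF ys(2)]) (simp_all only: len ys(1))
  ultimately have bij: "bij_betw ((!) ys \<circ> (\<lambda>i. i - 1)) {1..CARD('n)} UNIV"
    using bij_betw_trans by blast
  show ?thesis
  proof (rule that[OF bij])
    show "decr x i = x $ ((!) ys \<circ> (\<lambda>i. i - 1)) i" if "i \<in> {1..CARD('n)}" for i
    proof -
      have "i - 1 < length ys"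
        using that unfolding len atLeastAtMost_iff by linarith
      then show ?thesis
        by (simp only: decr_def L nth_map comp_def)
    qed
    show "x $ ((!) ys \<circ> (\<lambda>i. i - 1)) j \<le> x $ ((!) ys \<circ> (\<lambda>i. i - 1)) i"
      if "1 \<le> i" "i \<le> j" "j \<le> CARD('n)" for i j
    proof -
      have "i - 1 \<le> j - 1" "j - 1 < CARD('n)"
        using that by linarith+
      then show ?thesis
        unfolding comp_def by (rule mono)
    qed
  qed
qed

lemma decr_antimono:
  fixes x :: "real ^ 'n"
  assumes "1 \<le> i" "i \<le> j" "j \<le> CARD('n)"
  shows "decr x j \<le> decr x i"
proof -
  obtain \<pi> where \<pi>: "\<And>i. i \<in> {1..CARD('n)} \<Longrightarrow> decr x i = x $ \<pi> i"
    "\<And>i j. 1 \<le> i \<Longrightarrow> i \<le> j \<Longrightarrow> j \<le> CARD('n) \<Longrightarrow> x $ \<pi> j \<le> x $ \<pi> i"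
    by (rule decr_enumeration[of x]) blast
  have "i \<in> {1..CARD('n)}" "j \<in> {1..CARD('n)}"
    using assms by auto
  then show ?thesis
    using \<pi>(2)[OF assms] by (simp only: \<pi>(1))
qed

lemma sum_decr:
  fixes x :: "real ^ 'n"
  shows "(\<Sum>i=1..CARD('n). g (decr x i)) = (\<Sum>i\<in>UNIV. g (x $ i))"
proof -
  obtain \<pi> where \<pi>: "bij_betw \<pi> {1..CARD('n)} (UNIV :: 'n set)"
    "\<And>i. i \<in> {1..CARD('n)} \<Longrightarrow> decr x i = x $ \<pi> i"
    by (rule decr_enumeration[of x]) blast
  have "(\<Sum>i=1..CARD('n). g (decr x i)) = (\<Sum>i=1..CARD('n). g (x $ \<pi> i))"
    using \<pi>(2) by (intro sum.cong) auto
  also have "\<dots> = (\<Sum>i\<in>UNIV. g (x $ i))"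
    by (rule sum.reindex_bij_betw[OF \<pi>(1)])
  finally show ?thesis .
qed

text \<open>Truncation lowers no term, and the remaining truncated terms are non-negative. The bound
  is attained when \<open>t\<close> separates the first \<open>k\<close> values of
  \<open>decr x\<close> from the later ones, as in \<open>sum_excess_decr_eq\<close>.\<close>

lemma sum_excess_decr:
  fixes x :: "real ^ 'n"
  assumes "k \<le> CARD('n)"
  shows "(\<Sum>i=1..k. decr x i - t) \<le> (\<Sum>i\<in>UNIV. max 0 (x $ i - t))"
proof -
  have "(\<Sum>i=1..k. decr x i - t) \<le> (\<Sum>i=1..k. max 0 (decr x i - t))"
    by (intro sum_mono) simp
  also have "\<dots> \<le> (\<Sum>i=1..CARD('n). max 0 (decr x i - t))"
    using assms by (intro sum_mono2) auto
  finally show ?thesis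
    by (simp only: sum_decr[of "\<lambda>s. max 0 (s - t)"])
qed

lemma sum_excess_decr_eq:
  fixes x :: "real ^ 'n"
  assumes "k \<le> CARD('n)" and "\<And>i. i \<in> {1..k} \<Longrightarrow> t \<le> decr x i"
    and "\<And>i. i \<in> {k<..CARD('n)} \<Longrightarrow> decr x i \<le> t"
  shows "(\<Sum>i\<in>UNIV. max 0 (x $ i - t)) = (\<Sum>i=1..k. decr x i - t)"
proof -
  have "(\<Sum>i=1..CARD('n). max 0 (decr x i - t)) = (\<Sum>i=1..k. max 0 (decr x i - t))"
    using assms by (intro sum.mono_neutral_right) auto
  also have "\<dots> = (\<Sum>i=1..k. decr x i - t)"
    using assms(2) by (intro sum.cong) auto
  finally show ?thesis
    by (simp only: sum_decr[of "\<lambda>s. max 0 (s - t)"])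
qed

lemma coord_sum_le_sum_decr:
  fixes x :: "real ^ 'n"
  shows "coord_sum x A \<le> (\<Sum>i=1..card A. decr x i)"
proof (cases "A = {}")
  case False
  define k where "k = card A"
  have k: "1 \<le> k" "k \<le> CARD('n)"
    using False by (auto simp: k_def Suc_le_eq card_gt_0_iff intro: card_mono)
  \<comment> \<open>At this level the truncated excess of all coordinates equals the excess of the
    \<open>k\<close> largest entries and dominates that of \<open>A\<close>. Both sides contain
    \<open>k * t\<close>, which cancels.\<close>
  define t where "t = decr x k"
  have "(\<Sum>i\<in>A. x $ i - t) \<le> (\<Sum>i\<in>A. max 0 (x $ i - t))"
    by (intro sum_mono) simp
  also have "\<dots> \<le> (\<Sum>i\<in>UNIV. max 0 (x $ i - t))"
    by (intro sum_mono2) auto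
  also have "\<dots> = (\<Sum>i=1..k. decr x i - t)"
    using k by (intro sum_excess_decr_eq) (auto simp: t_def intro: decr_antimono)
  finally show ?thesis
    by (simp add: coord_sum_def sum_subtractf k_def)
qed (simp add: coord_sum_def)

section \<open>Majorization and sums of truncations\<close>

text \<open>With \<open>k\<close> the number of entries of \<open>x\<close> above \<open>t\<close>,
  the bound by the first \<open>k\<close> terms is exact for \<open>x\<close> and valid for
  \<open>y\<close>. Equal totals turn excess into deficit, because
  \<open>max 0 (t - s) = max 0 (s - t) + t - s\<close>.\<close>

lemma majorized_sum_deficit_le:
  fixes x y :: "real ^ 'n"
  assumes "majorized x y"
  shows "(\<Sum>i\<in>UNIV. max 0 (t - x $ i)) \<le> (\<Sum>i\<in>UNIV. max 0 (t - y $ i))"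
proof -
  define K where "K = {i \<in> {1..CARD('n)}. t < decr x i}"
  define k where "k = card K"
  have K: "K = {1..k}"
    unfolding k_def
  proof (rule down_closed_eq_atLeastAtMost)
    show "i \<in> K" if "1 \<le> i" "i \<le> j" "j \<in> K" for i j
      using that decr_antimono[of i j x] by (auto simp: K_def)
  qed (auto simp: K_def)
  have kn: "k \<le> CARD('n)"
    using card_mono[of "{1..CARD('n)}" K] by (simp add: k_def K_def subset_iff)
  have "t \<le> decr x i" if "i \<in> {1..k}" for i
  proof -
    have "i \<in> K"
      using that by (simp only: K)
    then show ?thesis
      by (simp add: K_def)
  qed
  moreover have "decr x i \<le> t" if "i \<in> {k<..CARD('n)}" for i
  proof -
    have "i \<notin> K"
      using that by (simp only: K) simp
    moreover have "i \<in> {1..CARD('n)}"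
      using that by simp
    ultimately show ?thesis
      by (simp add: K_def)
  qed
  ultimately have "(\<Sum>i\<in>UNIV. max 0 (x $ i - t)) = (\<Sum>i=1..k. decr x i - t)"
    using sum_excess_decr_eq[OF kn] by blast
  also have "\<dots> \<le> (\<Sum>i=1..k. decr y i - t)"
  proof (cases "k = 0")
    case False
    then have "(\<Sum>i=1..k. decr x i) \<le> (\<Sum>i=1..k. decr y i)"
      using assms kn by (simp add: majorized_def)
    then show ?thesis
      by (simp add: sum_subtractf)
  qed simp
  also have "\<dots> \<le> (\<Sum>i\<in>UNIV. max 0 (y $ i - t))"
    by (rule sum_excess_decr[OF kn])
  finally have *: "(\<Sum>i\<in>UNIV. max 0 (x $ i - t)) \<le> (\<Sum>i\<in>UNIV. max 0 (y $ i - t))" .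
  have "(\<Sum>i\<in>UNIV. max 0 (t - z $ i)) =
      (\<Sum>i\<in>UNIV. max 0 (z $ i - t)) + real CARD('n) * t - coord_sum z UNIV" for z :: "real ^ 'n"
  proof -
    have "(\<Sum>i\<in>UNIV. max 0 (t - z $ i)) = (\<Sum>i\<in>UNIV. max 0 (z $ i - t) + t - z $ i)"
      by (intro sum.cong) auto
    then show ?thesis
      by (simp add: coord_sum_def sum.distrib sum_subtractf)
  qed
  then show ?thesis
    using * assms by (simp add: majorized_def)
qed

text \<open>The excess of \<open>coord_sum x UNIV\<close> over \<open>coord_sum y UNIV\<close> is added to a largest entry of \<open>y\<close>:
  this leaves the sums of the \<open>j\<close> smallest entries unchanged for \<open>j < CARD('n)\<close>.\<close>

lemma majorizing_vector_above:
  fixes x y :: "real ^ 'n"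
  assumes def: "\<And>t. (\<Sum>i\<in>UNIV. max 0 (t - x $ i)) \<le> (\<Sum>i\<in>UNIV. max 0 (t - y $ i))"
    and tot: "coord_sum y UNIV \<le> coord_sum x UNIV"
  obtains v where "y \<le> v" "majorized x v"
proof -
  obtain \<pi> where \<pi>: "bij_betw \<pi> {1..CARD('n)} (UNIV :: 'n set)"
    "\<And>i j. 1 \<le> i \<Longrightarrow> i \<le> j \<Longrightarrow> j \<le> CARD('n) \<Longrightarrow> y $ \<pi> j \<le> y $ \<pi> i"
    by (rule decr_enumeration[of y]) blast
  obtain \<rho> where \<rho>: "bij_betw \<rho> {1..CARD('n)} (UNIV :: 'n set)"
    "\<And>i. i \<in> {1..CARD('n)} \<Longrightarrow> decr x i = x $ \<rho> i"
    by (rule decr_enumeration[of x]) blast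
  define \<delta> where "\<delta> = coord_sum x UNIV - coord_sum y UNIV"
  define v where "v = y + axis (\<pi> 1) \<delta>"
  have cs: "coord_sum v A = coord_sum y A + (if \<pi> 1 \<in> A then \<delta> else 0)" for A
    unfolding v_def coord_sum_add by (simp add: coord_sum_def axis_def)
  have "y \<le> v"
    using tot by (auto simp: v_def \<delta>_def less_eq_vec_def axis_def)
  moreover have "majorized x v"
    unfolding majorized_def
  proof (intro conjI ballI)
    show "coord_sum x UNIV = coord_sum v UNIV"
      by (simp add: cs \<delta>_def)
    fix k assume k: "k \<in> {1..CARD('n)}"
    define A where "A = \<rho> ` {1..k}"
    define B where "B = \<pi> ` {1..k}"
    \<comment> \<open>At the \<open>k\<close>-th largest entry of \<open>y\<close>, the deficit of
      \<open>y\<close> lives on \<open>- B\<close> and is untruncated there, while restricting to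
      \<open>- A\<close> and dropping the truncation only lower the deficit of \<open>x\<close>. One
      instance of \<open>def\<close> thus compares the sums of the \<open>CARD('n) - k\<close>
      smallest entries.\<close>
    define t where "t = y $ \<pi> k"
    have inj: "inj_on \<pi> {1..k}" "inj_on \<rho> {1..k}"
      using k \<pi>(1) \<rho>(1) by (auto simp: bij_betw_def intro: inj_on_subset)
    have card: "card A = k" "card B = k"
      using inj by (simp_all add: A_def B_def card_image)
    have yB: "t \<le> y $ i" if "i \<in> B" for i
      using that \<pi>(2) k by (auto simp: B_def t_def)
    have yB': "y $ i \<le> t" if "i \<in> - B" for i
    proof -
      obtain j where "i = \<pi> j" "j \<in> {1..CARD('n)}"
        using \<pi>(1) by (metis UNIV_I bij_betw_imp_surj_on imageE)
      then show ?thesis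
        using that \<pi>(2)[of k j] k by (cases "j \<le> k") (auto simp: B_def t_def)
    qed
    have "(\<Sum>i\<in>-A. max 0 (t - x $ i)) \<le> (\<Sum>i\<in>UNIV. max 0 (t - x $ i))"
      by (intro sum_mono2) auto
    also have "\<dots> \<le> (\<Sum>i\<in>UNIV. max 0 (t - y $ i))"
      by (rule def)
    also have "\<dots> = (\<Sum>i\<in>-B. max 0 (t - y $ i))"
      using yB by (intro sum.mono_neutral_right) auto
    also have "\<dots> = (\<Sum>i\<in>-B. t - y $ i)"
      using yB' by (intro sum.cong) auto
    finally have "(\<Sum>i\<in>-A. max 0 (t - x $ i)) \<le> (\<Sum>i\<in>-B. t - y $ i)" .
    moreover have "(\<Sum>i\<in>-A. t - x $ i) \<le> (\<Sum>i\<in>-A. max 0 (t - x $ i))"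
      by (intro sum_mono) simp
    moreover have "card (- A) = card (- B)"
      using card by (simp add: Compl_eq_Diff_UNIV card_Diff_subset)
    ultimately have "coord_sum y (- B) \<le> coord_sum x (- A)"
      by (simp add: coord_sum_def sum_subtractf)
    \<comment> \<open>The raised coordinate lies in \<open>B\<close>, so on \<open>B\<close> the sum
      of \<open>v\<close> is that of \<open>y\<close> plus \<open>\<delta>\<close>, which makes up
      for the difference of the totals.\<close>
    moreover have "\<pi> 1 \<in> B"
      using k by (auto simp: B_def)
    ultimately have "coord_sum x A \<le> coord_sum v B"
      using coord_sum_Compl[of x A] coord_sum_Compl[of y B] cs[of B] by (simp add: \<delta>_def)
    also have "\<dots> \<le> (\<Sum>i=1..k. decr v i)"
      using coord_sum_le_sum_decr[of v B] card by simp
    moreover have "coord_sum x A = (\<Sum>i=1..k. decr x i)"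
      using inj k \<rho>(2) by (simp add: coord_sum_def A_def sum.reindex)
    ultimately show "(\<Sum>i=1..k. decr x i) \<le> (\<Sum>i=1..k. decr v i)"
      by simp
  qed
  ultimately show ?thesis
    by (rule that)
qed

section \<open>Superlevel sets and Abel summation\<close>

lemma bij_betw_Collect_eq_image:
  assumes "bij_betw f A UNIV"
  shows "{i. P i} = f ` {j \<in> A. P (f j)}"
proof -
  have "{i. P i} = {i \<in> f ` A. P i}"
    unfolding bij_betw_imp_surj_on[OF assms] by simp
  then show ?thesis
    by auto
qed

lemma superlevel_eq_image:
  fixes x :: "real ^ 'n" and \<pi> :: "nat \<Rightarrow> 'n"
  assumes bij: "bij_betw \<pi> {1..CARD('n)} UNIV"
    and mono: "\<And>i j. 1 \<le> i \<Longrightarrow> i \<le> j \<Longrightarrow> j \<le> CARD('n) \<Longrightarrow> x $ \<pi> j \<le> x $ \<pi> i"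
  obtains k where "k \<le> CARD('n)" "{i. t \<le> x $ i} = \<pi> ` {1..k}"
proof -
  define K where "K = {j \<in> {1..CARD('n)}. t \<le> x $ \<pi> j}"
  have K: "K = {1..card K}"
  proof (rule down_closed_eq_atLeastAtMost)
    show "i \<in> K" if "1 \<le> i" "i \<le> j" "j \<in> K" for i j
      using that mono[of i j] by (auto simp: K_def)
  qed (auto simp: K_def)
  have "{i. t \<le> x $ i} = \<pi> ` K"
    unfolding K_def by (rule bij_betw_Collect_eq_image[OF bij])
  moreover have "card K \<le> CARD('n)"
    using card_mono[of "{1..CARD('n)}" K] by (simp add: K_def subset_iff)
  moreover have "\<pi> ` K = \<pi> ` {1..card K}"
    by (rule arg_cong[OF K])
  ultimately show ?thesis
    using that[of "card K"] by simp
qed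

lemma coord_sum_image_enumeration:
  fixes x :: "real ^ 'n" and \<pi> :: "nat \<Rightarrow> 'n"
  assumes "bij_betw \<pi> {1..CARD('n)} UNIV" "k \<le> CARD('n)"
  shows "coord_sum x (\<pi> ` {1..k}) = (\<Sum>i=1..k. x $ \<pi> i)"
proof -
  have "inj_on \<pi> {1..k}"
    using assms by (auto simp: bij_betw_def intro: inj_on_subset)
  then show ?thesis
    by (simp add: coord_sum_def sum.reindex)
qed

text \<open>Summation by parts. The sign condition concerns the product, so that nothing is asked of
  a partial sum of \<open>d\<close> where \<open>c\<close> does not change.\<close>

lemma abel_sum_ge:
  fixes c d :: "nat \<Rightarrow> real"
  assumes "1 \<le> n" and "\<And>k. 1 \<le> k \<Longrightarrow> k < n \<Longrightarrow> 0 \<le> (c k - c (Suc k)) * (\<Sum>i=1..k. d i)"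
  shows "c n * (\<Sum>i=1..n. d i) \<le> (\<Sum>i=1..n. c i * d i)"
  using assms
proof (induction n rule: dec_induct)
  case (step k)
  have "c k * (\<Sum>i=1..k. d i) \<le> (\<Sum>i=1..k. c i * d i)"
    using step by simp
  moreover have "0 \<le> (c k - c (Suc k)) * (\<Sum>i=1..k. d i)"
    using step by simp
  ultimately show ?case
    by (simp add: algebra_simps)
qed simp

text \<open>Abel summation in decreasing order of \<open>c\<close> leaves the smallest entry of
  \<open>c\<close> times the total of \<open>d\<close>. The second assumption makes this
  non-negative: if \<open>c\<close> is non-negative, its superlevel set at 0 is
  \<open>UNIV\<close>.\<close>

lemma inner_nonneg_of_superlevel_sums:
  fixes c d :: "real ^ 'n"
  assumes lev: "\<And>t. 0 \<le> coord_sum d {i. t \<le> c $ i}"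
    and "(\<forall>i. 0 \<le> c $ i) \<or> coord_sum d UNIV = 0"
  shows "0 \<le> (\<Sum>i\<in>UNIV. c $ i * d $ i)"
proof -
  let ?n = "CARD('n)"
  obtain \<pi> where bij: "bij_betw \<pi> {1..?n} (UNIV :: 'n set)"
    and mono: "\<And>i j. 1 \<le> i \<Longrightarrow> i \<le> j \<Longrightarrow> j \<le> ?n \<Longrightarrow> c $ \<pi> j \<le> c $ \<pi> i"
    by (rule decr_enumeration[of c]) blast
  have n: "1 \<le> ?n"
    by (simp add: Suc_le_eq)
  have "0 \<le> (c $ \<pi> k - c $ \<pi> (Suc k)) * (\<Sum>i=1..k. d $ \<pi> i)" if k: "1 \<le> k" "k < ?n" for k
  \<comment> \<open>The first \<open>k\<close> indices form a superlevel set only at a strict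
    descent; at a tie the difference of the entries of \<open>c\<close> is zero.\<close>
  proof (cases "c $ \<pi> (Suc k) < c $ \<pi> k")
    case True
    have sup: "c $ \<pi> k \<le> c $ \<pi> j \<longleftrightarrow> j \<le> k" if "j \<in> {1..?n}" for j
    proof
      show "c $ \<pi> k \<le> c $ \<pi> j" if "j \<le> k"
        using mono[of j k] k that \<open>j \<in> {1..?n}\<close> by simp
      show "j \<le> k" if "c $ \<pi> k \<le> c $ \<pi> j"
      proof (rule ccontr)
        assume "\<not> j \<le> k"
        then have "c $ \<pi> j \<le> c $ \<pi> (Suc k)"
          using mono[of "Suc k" j] \<open>j \<in> {1..?n}\<close> by simp
        then show False
          using that True by simp
      qed
    qed
    have "{i. c $ \<pi> k \<le> c $ i} = \<pi> ` {j \<in> {1..?n}. c $ \<pi> k \<le> c $ \<pi> j}"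
      by (rule bij_betw_Collect_eq_image[OF bij])
    also have "{j \<in> {1..?n}. c $ \<pi> k \<le> c $ \<pi> j} = {1..k}"
      using sup k by auto
    finally have "0 \<le> (\<Sum>i=1..k. d $ \<pi> i)"
      using lev[of "c $ \<pi> k"] coord_sum_image_enumeration[OF bij, of k d] k by simp
    then show ?thesis
      using True by simp
  next
    case False
    then have "c $ \<pi> (Suc k) = c $ \<pi> k"
      using mono[of k "Suc k"] k by simp
    then show ?thesis
      by simp
  qed
  then have "c $ \<pi> ?n * (\<Sum>i=1..?n. d $ \<pi> i) \<le> (\<Sum>i=1..?n. c $ \<pi> i * d $ \<pi> i)"
    by (rule abel_sum_ge[OF n])
  also have "\<dots> = (\<Sum>i\<in>UNIV. c $ i * d $ i)"
    by (rule sum.reindex_bij_betw[OF bij])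
  also have "(\<Sum>i=1..?n. d $ \<pi> i) = coord_sum d UNIV"
    unfolding coord_sum_def by (rule sum.reindex_bij_betw[OF bij])
  finally have *: "c $ \<pi> ?n * coord_sum d UNIV \<le> (\<Sum>i\<in>UNIV. c $ i * d $ i)" .
  have "0 \<le> c $ \<pi> ?n * coord_sum d UNIV"
    using assms(2)
  proof
    assume c: "\<forall>i. 0 \<le> c $ i"
    then have "0 \<le> coord_sum d UNIV"
      using lev[of 0] by simp
    then show ?thesis
      using c by simp
  qed simp
  with * show ?thesis
    by linarith
qed

section \<open>From supermajorization to Schur-convexity and permutations\<close>

text \<open>Truncations and negation as test functions provide some \<open>v\<close> above
  \<open>y + b\<close> that majorizes \<open>x + b\<close>. Schur-convexity then bounds
  \<open>\<Phi> (x + b)\<close> by \<open>\<Phi> v\<close>, and monotonicity bounds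
  \<open>\<Phi> v\<close> by \<open>\<Phi> (y + b)\<close>.\<close>

lemma weakly_supermajorized_imp_schur_le:
  fixes x y b :: "real ^ 'n"
  assumes le: "weakly_supermajorized 1 b x y"
    and \<Phi>: "antimono \<Phi>" "Schur_convex \<Phi>"
  shows "\<Phi> (x + b) \<le> \<Phi> (y + b)"
proof -
  have *: "(\<Sum>i\<in>UNIV. \<phi> ((x + b) $ i)) \<le> (\<Sum>i\<in>UNIV. \<phi> ((y + b) $ i))"
    if "antimono \<phi>" "continuous_on UNIV \<phi>" "convex_on UNIV \<phi>" for \<phi> :: "real \<Rightarrow> real"
    using le that by (simp add: weakly_supermajorized_def)
  have "convex_on UNIV (\<lambda>s. max 0 (t - s))" for t :: real
  proof (rule convex_onI)
    fix u v w :: real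
    assume "0 < u" "u < 1"
    then have "0 \<le> (1 - u) * max 0 (t - v) + u * max 0 (t - w)"
      by (intro add_nonneg_nonneg mult_nonneg_nonneg) auto
    moreover have "(1 - u) * (t - v) + u * (t - w) \<le> (1 - u) * max 0 (t - v) + u * max 0 (t - w)"
      using \<open>0 < u\<close> \<open>u < 1\<close> by (intro add_mono mult_left_mono) auto
    moreover have "t - ((1 - u) *\<^sub>R v + u *\<^sub>R w) = (1 - u) * (t - v) + u * (t - w)"
      by (simp add: algebra_simps)
    ultimately show "max 0 (t - ((1 - u) *\<^sub>R v + u *\<^sub>R w)) \<le> (1 - u) * max 0 (t - v) + u * max 0 (t - w)"
      by simp
  qed simp
  then have def: "(\<Sum>i\<in>UNIV. max 0 (t - (x + b) $ i)) \<le> (\<Sum>i\<in>UNIV. max 0 (t - (y + b) $ i))" for t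
    by (intro *) (auto intro!: antimonoI continuous_intros)
  have "(\<Sum>i\<in>UNIV. - (x + b) $ i) \<le> (\<Sum>i\<in>UNIV. - (y + b) $ i)"
    by (intro *) (auto intro!: antimonoI continuous_intros convex_onI)
  then have "coord_sum (y + b) UNIV \<le> coord_sum (x + b) UNIV"
    by (simp only: coord_sum_def sum_negf neg_le_iff_le)
  then obtain v where "y + b \<le> v" "majorized (x + b) v"
    using majorizing_vector_above[OF def] by blast
  then have "\<Phi> (x + b) \<le> \<Phi> v" "\<Phi> v \<le> \<Phi> (y + b)"
    using \<Phi> by (auto simp: Schur_convex_def dest: antimonoD)
  then show ?thesis
    by simp
qed

text \<open>The entries of \<open>b\<close> are spaced so widely that adding \<open>b\<close> arranges the entries of every
  \<open>x \<in> C\<close> in the order prescribed by \<open>\<pi>\<close>; a truncation at a level between two consecutive entries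
  then sees exactly the partial sums along \<open>\<pi>\<close>.\<close>

lemma schur_minimal_imp_simultaneous_max:
  fixes C :: "(real ^ 'n) set" and \<pi> :: "nat \<Rightarrow> 'n"
  assumes "compact C" and bij: "bij_betw \<pi> {1..CARD('n)} UNIV"
    and schur: "\<forall>b. \<exists>xs\<in>C. \<forall>\<Phi>. antimono \<Phi> \<and> continuous_on UNIV \<Phi> \<and> Schur_convex \<Phi> \<longrightarrow>
                 (\<forall>x\<in>C. \<Phi> (xs + b) \<le> \<Phi> (x + b))"
  shows "\<exists>xs\<in>C. \<forall>x\<in>C. \<forall>k\<in>{1..CARD('n)}. (\<Sum>i=1..k. x $ \<pi> i) \<le> (\<Sum>i=1..k. xs $ \<pi> i)"
proof -
  let ?n = "CARD('n)"
  obtain M where M: "0 < M" "\<And>x. x \<in> C \<Longrightarrow> norm x \<le> M"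
    using compact_imp_bounded[OF \<open>compact C\<close>] by (auto simp: bounded_pos)
  have nth: "- M \<le> x $ i" "x $ i \<le> M" if "x \<in> C" for x i
    using M(2)[OF that] component_le_norm_cart[of x i] by linarith+
  \<comment> \<open>Entry \<open>\<pi> j\<close> of \<open>x + b\<close> lies between
    \<open>2 * M * j - M\<close> and \<open>2 * M * j + M\<close>; for consecutive \<open>j\<close>
    these intervals meet only in an endpoint.\<close>
  define b :: "real ^ 'n" where "b = (\<chi> i. 2 * M * real (inv_into {1..?n} \<pi> i))"
  have b: "b $ \<pi> j = 2 * M * real j" if "j \<in> {1..?n}" for j
    using that bij by (simp add: b_def bij_betw_def inv_into_f_f)
  obtain xs where xs: "xs \<in> C" and min: "\<And>\<Phi> x. antimono \<Phi> \<Longrightarrow> continuous_on UNIV \<Phi> \<Longrightarrow>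
      Schur_convex \<Phi> \<Longrightarrow> x \<in> C \<Longrightarrow> \<Phi> (xs + b) \<le> \<Phi> (x + b)"
    using schur by blast
  have "(\<Sum>i=1..k. x $ \<pi> i) \<le> (\<Sum>i=1..k. xs $ \<pi> i)" if x: "x \<in> C" and k: "k \<in> {1..?n}" for x k
  proof -
    \<comment> \<open>The endpoint shared by the intervals of \<open>k\<close> and
      \<open>k + 1\<close>: terms of \<open>\<Phi>\<close> beyond \<open>k\<close> vanish and the
      first \<open>k\<close> are not truncated.\<close>
    define t where "t = 2 * M * real k + M"
    define \<Phi> :: "real ^ 'n \<Rightarrow> real" where "\<Phi> z = (\<Sum>i\<in>UNIV. max 0 (t - z $ i))" for z
    \<comment> \<open>Only the last sum depends on \<open>y\<close>, so minimising
      \<open>\<Phi>\<close> maximises it. As \<open>b\<close> does not depend on \<open>k\<close>,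
      one \<open>xs\<close> serves all \<open>k\<close>.\<close>
    have \<Phi>: "\<Phi> (y + b) = (\<Sum>j=1..k. t - 2 * M * real j) - (\<Sum>j=1..k. y $ \<pi> j)" if "y \<in> C" for y
    proof -
      have "\<Phi> (y + b) = (\<Sum>j=1..?n. max 0 (t - (y + b) $ \<pi> j))"
        unfolding \<Phi>_def by (rule sum.reindex_bij_betw[OF bij, symmetric])
      also have "\<dots> = (\<Sum>j=1..k. max 0 (t - (y + b) $ \<pi> j))"
      proof (intro sum.mono_neutral_right ballI)
        fix j assume j: "j \<in> {1..?n} - {1..k}"
        then have "2 * M * (real k + 1) \<le> 2 * M * real j"
          using M(1) by (intro mult_left_mono) auto
        then show "max 0 (t - (y + b) $ \<pi> j) = 0"
          using j b[of j] nth[OF that, of "\<pi> j"] by (simp add: t_def algebra_simps)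
      qed (use k in auto)
      also have "\<dots> = (\<Sum>j=1..k. (t - 2 * M * real j) - y $ \<pi> j)"
      proof (intro sum.cong refl)
        fix j assume j: "j \<in> {1..k}"
        then have "2 * M * real j \<le> 2 * M * real k"
          using M(1) by (intro mult_left_mono) auto
        then show "max 0 (t - (y + b) $ \<pi> j) = (t - 2 * M * real j) - y $ \<pi> j"
          using j k b[of j] nth[OF that, of "\<pi> j"] by (simp add: t_def)
      qed
      finally show ?thesis
        by (simp only: sum_subtractf)
    qed
    have "antimono \<Phi>"
      unfolding \<Phi>_def
      by (intro antimonoI sum_mono max.mono) (auto simp: less_eq_vec_def)
    moreover have "continuous_on UNIV \<Phi>"
      unfolding \<Phi>_def by (intro continuous_intros)
    moreover have "Schur_convex \<Phi>"
      by (simp add: Schur_convex_def \<Phi>_def majorized_sum_deficit_le)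
    ultimately have "\<Phi> (xs + b) \<le> \<Phi> (x + b)"
      using x by (rule min)
    then show ?thesis
      using \<Phi>[OF x] \<Phi>[OF xs] by simp
  qed
  with xs show ?thesis
    by blast
qed

section \<open>The support function of \<open>C\<close> and its submodularity\<close>

lemma support_max_attained:
  assumes "compact C" "C \<noteq> {}"
  obtains x where "x \<in> C" "coord_sum x A = support_max C A"
    and "\<And>y. y \<in> C \<Longrightarrow> coord_sum y A \<le> support_max C A"
proof -
  have "continuous_on C (\<lambda>x. coord_sum x A)"
    unfolding coord_sum_def by (intro continuous_intros)
  then obtain x where x: "x \<in> C" "\<And>y. y \<in> C \<Longrightarrow> coord_sum y A \<le> coord_sum x A"
    using continuous_attains_sup[OF assms, of "\<lambda>x. coord_sum x A"] by blast
  then have "support_max C A = coord_sum x A"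
    unfolding support_max_def by (intro Greatest_equality) auto
  with x show ?thesis
    using that by simp
qed

lemma coord_sum_le_support_max:
  assumes "compact C" "x \<in> C"
  shows "coord_sum x A \<le> support_max C A"
proof -
  have "C \<noteq> {}"
    using assms by blast
  with \<open>compact C\<close> show ?thesis
    by (rule support_max_attained[where A = A]) (use assms in blast)
qed

lemma support_max_eqI:
  assumes "compact C" "x \<in> C" "\<And>y. y \<in> C \<Longrightarrow> coord_sum y A \<le> coord_sum x A"
  shows "support_max C A = coord_sum x A"
  unfolding support_max_def using assms by (intro Greatest_equality) auto

text \<open>This frees (4) of permutations: when \<open>\<pi>\<close> lists the coordinates by
  decreasing \<open>c\<close>, superlevel sets are initial segments. Any chain of sets consists of
  superlevel sets of some \<open>c\<close>.\<close>

lemma simultaneous_max_at_superlevels: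
  fixes C :: "(real ^ 'n) set" and c :: "real ^ 'n"
  assumes "compact C"
    and sim: "\<forall>\<pi> :: nat \<Rightarrow> 'n. bij_betw \<pi> {1..CARD('n)} UNIV \<longrightarrow>
      (\<exists>xs\<in>C. \<forall>x\<in>C. \<forall>k\<in>{1..CARD('n)}. (\<Sum>i=1..k. x $ \<pi> i) \<le> (\<Sum>i=1..k. xs $ \<pi> i))"
  obtains xs where "xs \<in> C" "\<And>t. coord_sum xs {i. t \<le> c $ i} = support_max C {i. t \<le> c $ i}"
proof -
  obtain \<pi> where bij: "bij_betw \<pi> {1..CARD('n)} (UNIV :: 'n set)"
    and mono: "\<And>i j. 1 \<le> i \<Longrightarrow> i \<le> j \<Longrightarrow> j \<le> CARD('n) \<Longrightarrow> c $ \<pi> j \<le> c $ \<pi> i"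
    by (rule decr_enumeration[of c]) blast
  obtain xs where xs: "xs \<in> C" and
    max: "\<And>x k. x \<in> C \<Longrightarrow> k \<in> {1..CARD('n)} \<Longrightarrow> (\<Sum>i=1..k. x $ \<pi> i) \<le> (\<Sum>i=1..k. xs $ \<pi> i)"
    using sim bij by blast
  have "support_max C {i. t \<le> c $ i} = coord_sum xs {i. t \<le> c $ i}" for t
  proof (rule support_max_eqI[OF \<open>compact C\<close> xs])
    fix x assume x: "x \<in> C"
    obtain k where k: "k \<le> CARD('n)" "{i. t \<le> c $ i} = \<pi> ` {1..k}"
      using superlevel_eq_image[OF bij mono, of t] by blast
    show "coord_sum x {i. t \<le> c $ i} \<le> coord_sum xs {i. t \<le> c $ i}"
      unfolding k(2) coord_sum_image_enumeration[OF bij k(1)]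
      using max[OF x, of k] k(1) by (cases "k = 0") auto
  qed
  then show ?thesis
    by (intro that[OF xs]) simp
qed

lemma simultaneous_max_imp_submodular:
  fixes C :: "(real ^ 'n) set"
  assumes "compact C"
    and sim: "\<forall>\<pi> :: nat \<Rightarrow> 'n. bij_betw \<pi> {1..CARD('n)} UNIV \<longrightarrow>
      (\<exists>xs\<in>C. \<forall>x\<in>C. \<forall>k\<in>{1..CARD('n)}. (\<Sum>i=1..k. x $ \<pi> i) \<le> (\<Sum>i=1..k. xs $ \<pi> i))"
  shows "submodular (support_max C)"
  unfolding submodular_def
proof (intro conjI allI)
  obtain xs where "xs \<in> C"
    using simultaneous_max_at_superlevels[OF assms] by blast
  then show "support_max C {} = 0"
    using support_max_eqI[OF \<open>compact C\<close>, of xs "{}"] by (simp add: coord_sum_def)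
next
  fix A B :: "'n set"
  \<comment> \<open>The values 2, 1, 0 make both nested sets superlevel sets, so a single point
    \<open>xs\<close> attains the maximum on each.\<close>
  define c :: "real ^ 'n" where
    "c = (\<chi> i. if i \<in> A \<inter> B then 2 else if i \<in> A \<union> B then 1 else 0)"
  obtain xs where xs: "xs \<in> C"
    and max: "\<And>t. coord_sum xs {i. t \<le> c $ i} = support_max C {i. t \<le> c $ i}"
    using simultaneous_max_at_superlevels[OF assms, of c] by blast
  have "{i. 2 \<le> c $ i} = A \<inter> B" "{i. 1 \<le> c $ i} = A \<union> B"
    by (auto simp: c_def)
  then have "support_max C (A \<union> B) + support_max C (A \<inter> B) = coord_sum xs A + coord_sum xs B"
    using max[of 1] max[of 2] coord_sum_Un_Int[of xs A B] by simp
  then show "support_max C (A \<union> B) + support_max C (A \<inter> B) \<le> support_max C A + support_max C B"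
    using coord_sum_le_support_max[OF \<open>compact C\<close> xs, of A]
      coord_sum_le_support_max[OF \<open>compact C\<close> xs, of B] by simp
qed

text \<open>A point of the base polyhedron outside \<open>C\<close> would be separated from \<open>C\<close> by some \<open>c\<close>; but the
  element of \<open>C\<close> that is maximal along the order of \<open>c\<close> maximises \<open>c\<close> over the base polyhedron.\<close>

lemma simultaneous_max_imp_base_subset:
  fixes C :: "(real ^ 'n) set"
  assumes "compact C" "convex C"
    and sim: "\<forall>\<pi> :: nat \<Rightarrow> 'n. bij_betw \<pi> {1..CARD('n)} UNIV \<longrightarrow>
      (\<exists>xs\<in>C. \<forall>x\<in>C. \<forall>k\<in>{1..CARD('n)}. (\<Sum>i=1..k. x $ \<pi> i) \<le> (\<Sum>i=1..k. xs $ \<pi> i))"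
  shows "base_polyhedron (support_max C) \<subseteq> C"
proof (rule subsetI, rule ccontr)
  fix z assume z: "z \<in> base_polyhedron (support_max C)" "z \<notin> C"
  obtain a \<beta> where a: "inner a z < \<beta>" "\<forall>x\<in>C. \<beta> < inner a x"
    using separating_hyperplane_closed_point[OF \<open>convex C\<close> compact_imp_closed[OF \<open>compact C\<close>] z(2)]
    by blast
  \<comment> \<open>Separation puts \<open>z\<close> on the smaller side of \<open>a\<close>, so the
    order is taken from \<open>- a\<close>.\<close>
  obtain xs where xs: "xs \<in> C"
    and max: "\<And>t. coord_sum xs {i. t \<le> (- a) $ i} = support_max C {i. t \<le> (- a) $ i}"
    using simultaneous_max_at_superlevels[OF \<open>compact C\<close> sim] by blast
  have sep: "inner a z < inner a xs"
    using a(1) bspec[OF a(2) xs] by (rule less_trans)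
  \<comment> \<open>At a level that no entry falls below, the superlevel set is \<open>UNIV\<close>;
    hence \<open>xs\<close> and \<open>z\<close> have equal totals, and the sign of
    \<open>- a\<close> is irrelevant.\<close>
  obtain t where t: "\<And>i. t \<le> (- a) $ i"
  proof
    show "Min (range (($) (- a))) \<le> (- a) $ i" for i
      by (intro Min_le) auto
  qed
  have sub: "coord_sum (xs - z) A = coord_sum xs A - coord_sum z A" for A
    by (simp add: coord_sum_def sum_subtractf)
  have "0 \<le> (\<Sum>i\<in>UNIV. (- a) $ i * (xs - z) $ i)"
  proof (rule inner_nonneg_of_superlevel_sums)
    show "0 \<le> coord_sum (xs - z) {i. t \<le> (- a) $ i}" for t
      using z max[of t] by (simp add: sub base_polyhedron_def submodular_polyhedron_def)
    have "{i. t \<le> (- a) $ i} = UNIV"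
      using t by auto
    then have "coord_sum (xs - z) UNIV = 0"
      using z max[of t] by (simp add: sub base_polyhedron_def)
    then show "(\<forall>i. 0 \<le> (- a) $ i) \<or> coord_sum (xs - z) UNIV = 0" ..
  qed
  also have "\<dots> = inner (- a) (xs - z)"
    by (simp add: inner_vec_def)
  finally show False
    using sep by (simp add: inner_diff_right)
qed

section \<open>Tight sets and the quadratic minimiser\<close>

text \<open>Uncrossing: submodularity of \<open>f\<close> and modularity of coordinate sums leave no
  slack in the bounds for union and intersection.\<close>

lemma tight_Un_Int:
  assumes "submodular f" "x \<in> submodular_polyhedron f"
    and "coord_sum x A = f A" "coord_sum x B = f B"
  shows "coord_sum x (A \<union> B) = f (A \<union> B)" "coord_sum x (A \<inter> B) = f (A \<inter> B)"
proof -
  have "f (A \<union> B) + f (A \<inter> B) \<le> f A + f B"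
    using assms(1) by (simp add: submodular_def)
  moreover have "coord_sum x (A \<union> B) \<le> f (A \<union> B)" "coord_sum x (A \<inter> B) \<le> f (A \<inter> B)"
    using assms(2) by (simp_all add: submodular_polyhedron_def)
  ultimately show "coord_sum x (A \<union> B) = f (A \<union> B)" "coord_sum x (A \<inter> B) = f (A \<inter> B)"
    using coord_sum_Un_Int[of x A B] assms(3,4) by linarith+
qed

text \<open>Tight sets form a lattice. For fixed \<open>i\<close> in \<open>L\<close>, intersecting
  tight sets that contain \<open>i\<close> and omit each \<open>j\<close> outside \<open>L\<close>
  gives a tight set inside \<open>L\<close>; the union over \<open>i\<close> is \<open>L\<close>.
  Tightness of \<open>UNIV\<close> and \<open>{}\<close> covers the empty intersection and
  union.\<close>

lemma tight_of_separated:
  fixes x :: "real ^ 'n"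
  assumes f: "submodular f" and x: "x \<in> base_polyhedron f"
    and sep: "\<And>i j. i \<in> L \<Longrightarrow> j \<notin> L \<Longrightarrow> \<exists>A. i \<in> A \<and> j \<notin> A \<and> coord_sum x A = f A"
  shows "coord_sum x L = f L"
proof -
  define T where "T = {A. coord_sum x A = f A}"
  have "x \<in> submodular_polyhedron f" and UNIV: "UNIV \<in> T"
    using x by (simp_all add: base_polyhedron_def T_def)
  then have Un: "A \<union> B \<in> T" and Int: "A \<inter> B \<in> T" if "A \<in> T" "B \<in> T" for A B
    using that tight_Un_Int[OF f] by (simp_all add: T_def)
  have empty: "{} \<in> T"
    using f by (simp add: T_def coord_sum_def submodular_def)
  have sep: "\<exists>A\<in>T. i \<in> A \<and> j \<notin> A" if "i \<in> L" "j \<notin> L" for i j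
    using sep[OF that] by (simp add: T_def Bex_def conj_ac)
  have "\<exists>B\<in>T. i \<in> B \<and> B \<subseteq> L" if i: "i \<in> L" for i
  proof -
    have "\<forall>j\<in>-L. \<exists>A. A \<in> T \<and> i \<in> A \<and> j \<notin> A"
      using sep[OF i] by auto
    then obtain A where A: "\<And>j. j \<in> - L \<Longrightarrow> A j \<in> T \<and> i \<in> A j \<and> j \<notin> A j"
      unfolding bchoice_iff by auto
    have "(\<Inter>j\<in>S. A j) \<in> T" if "S \<subseteq> - L" for S
      using finite[of S] that
      by (induction S rule: finite_induct) (simp_all add: UNIV Int A)
    then have "(\<Inter>j\<in>-L. A j) \<in> T"
      by simp
    moreover have "i \<in> (\<Inter>j\<in>-L. A j)"
      using A by simp
    moreover have "(\<Inter>j\<in>-L. A j) \<subseteq> L"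
    proof
      fix j assume j: "j \<in> (\<Inter>j\<in>-L. A j)"
      show "j \<in> L"
      proof (rule ccontr)
        assume "j \<notin> L"
        then have "j \<in> - L"
          by simp
        then show False
          using j A[of j] by simp
      qed
    qed
    ultimately show ?thesis
      by (intro bexI[of _ "\<Inter>j\<in>-L. A j"] conjI)
  qed
  then have "\<forall>i\<in>L. \<exists>B. B \<in> T \<and> i \<in> B \<and> B \<subseteq> L"
    by auto
  then obtain B where B: "\<And>i. i \<in> L \<Longrightarrow> B i \<in> T \<and> i \<in> B i \<and> B i \<subseteq> L"
    unfolding bchoice_iff by auto
  have "(\<Union>i\<in>S. B i) \<in> T" if "S \<subseteq> L" for S
    using finite[of S] that
    by (induction S rule: finite_induct) (simp_all add: empty Un B)
  then have "(\<Union>i\<in>L. B i) \<in> T"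
    by simp
  moreover have "(\<Union>i\<in>L. B i) = L"
  proof
    show "(\<Union>i\<in>L. B i) \<subseteq> L"
      using B by (intro UN_least) simp
    show "L \<subseteq> (\<Union>i\<in>L. B i)"
      using B by blast
  qed
  ultimately show ?thesis
    by (simp add: T_def)
qed

text \<open>If no tight set separates \<open>i\<close> from \<open>j\<close>, then a small amount can be moved from coordinate \<open>j\<close> to
  coordinate \<open>i\<close> inside the base polyhedron, which decreases the quadratic objective.\<close>

lemma tight_separation_of_minimiser:
  fixes x a b :: "real ^ 'n"
  assumes a: "\<And>i. 0 < a $ i" and x: "x \<in> base_polyhedron f"
    and min: "\<And>y. y \<in> base_polyhedron f \<Longrightarrow>
      (\<Sum>k\<in>UNIV. (x $ k + b $ k)\<^sup>2 / a $ k) \<le> (\<Sum>k\<in>UNIV. (y $ k + b $ k)\<^sup>2 / a $ k)"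
    and ij: "(x $ i + b $ i) / a $ i < (x $ j + b $ j) / a $ j"
  shows "\<exists>A. i \<in> A \<and> j \<notin> A \<and> coord_sum x A = f A"
proof (rule ccontr)
  assume "\<not> ?thesis"
  then have slack: "0 < f A - coord_sum x A" if "i \<in> A" "j \<notin> A" for A
    using that x by (force simp: base_polyhedron_def submodular_polyhedron_def order_less_le)
  define \<A> where "\<A> = {A. i \<in> A \<and> j \<notin> A}"
  define zi where "zi = (x $ i + b $ i) / a $ i"
  define zj where "zj = (x $ j + b $ j) / a $ j"
  \<comment> \<open>The objective will change by \<open>e * (2 * (zi - zj) + e * s)\<close>, which
    is negative once \<open>e * s \<le> zj - zi\<close>. The slacks in the minimum defining
    \<open>e\<close> keep the shifted point in the polyhedron.\<close>
  define s where "s = 1 / a $ i + 1 / a $ j"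
  define e where "e = Min (insert ((zj - zi) / s) ((\<lambda>A. f A - coord_sum x A) ` \<A>))"
  have z: "zi < zj"
    using ij by (simp add: zi_def zj_def)
  have "i \<noteq> j"
    using ij by auto
  have s: "0 < s"
    using a by (simp add: s_def add_pos_pos)
  have e: "0 < e"
    unfolding e_def using slack z s by (subst Min_gr_iff) (auto simp: \<A>_def)
  have "e \<le> (zj - zi) / s"
    unfolding e_def by (intro Min_le) auto
  then have es: "e * s \<le> zj - zi"
    using s by (simp add: pos_le_divide_eq)
  have eA: "e \<le> f A - coord_sum x A" if "i \<in> A" "j \<notin> A" for A
    unfolding e_def using that by (intro Min_le) (auto simp: \<A>_def)
  define y where "y = x + (axis i e + axis j (- e))"
  have y: "y $ k = x $ k + (if k = i then e else if k = j then - e else 0)" for k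
    using \<open>i \<noteq> j\<close> by (auto simp: y_def axis_def)
  have cy: "coord_sum y A = coord_sum x A + ((if i \<in> A then e else 0) + (if j \<in> A then - e else 0))" for A
    unfolding y_def coord_sum_add by (simp add: coord_sum_def axis_def sum.distrib)
  have "coord_sum y A \<le> f A" for A
  proof (cases "i \<in> A \<and> j \<notin> A")
    case True
    then show ?thesis
      using eA[of A] by (simp add: cy)
  next
    case False
    then have "coord_sum y A \<le> coord_sum x A"
      using e by (auto simp: cy)
    also have "\<dots> \<le> f A"
      using x by (simp add: base_polyhedron_def submodular_polyhedron_def)
    finally show ?thesis .
  qed
  moreover have "coord_sum y UNIV = f UNIV"
    using x by (simp add: cy base_polyhedron_def)
  ultimately have "y \<in> base_polyhedron f"
    by (simp add: base_polyhedron_def submodular_polyhedron_def)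
  then have "0 \<le> (\<Sum>k\<in>UNIV. (y $ k + b $ k)\<^sup>2 / a $ k - (x $ k + b $ k)\<^sup>2 / a $ k)"
    using min by (simp add: sum_subtractf)
  also have "\<dots> = (\<Sum>k\<in>{i, j}. (y $ k + b $ k)\<^sup>2 / a $ k - (x $ k + b $ k)\<^sup>2 / a $ k)"
    by (intro sum.mono_neutral_right) (auto simp: y)
  also have "\<dots> = e * (2 * (zi - zj) + e * s)"
  proof -
    have sq: "(p + r)\<^sup>2 / q - p\<^sup>2 / q = r * (2 * (p / q) + r * (1 / q))" for p q r :: real
      by (simp add: power2_eq_square add_divide_distrib algebra_simps)
    have "(y $ i + b $ i)\<^sup>2 / a $ i - (x $ i + b $ i)\<^sup>2 / a $ i = e * (2 * zi + e * (1 / a $ i))"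
      using sq[of "x $ i + b $ i" e "a $ i"] by (simp add: y zi_def add.commute add.left_commute)
    moreover have "(y $ j + b $ j)\<^sup>2 / a $ j - (x $ j + b $ j)\<^sup>2 / a $ j = - e * (2 * zj + - e * (1 / a $ j))"
      using sq[of "x $ j + b $ j" "- e" "a $ j"] \<open>i \<noteq> j\<close>
      by (simp add: y zj_def add_diff_eq add.commute add.left_commute)
    ultimately show ?thesis
      using \<open>i \<noteq> j\<close> by (simp add: s_def algebra_simps)
  qed
  also have "\<dots> < 0"
    using e es z by (intro mult_pos_neg) auto
  finally show False
    by simp
qed

text \<open>The sign follows from comparing \<open>s\<close> with \<open>s + 1\<close>, monotonicity
  from adding the subgradient inequalities at two points.\<close>

lemma convex_antimono_subgradient:
  fixes \<phi> :: "real \<Rightarrow> real"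
  assumes "convex_on UNIV \<phi>" "antimono \<phi>"
  shows "\<exists>g. (\<forall>s w. \<phi> s + g s * (w - s) \<le> \<phi> w) \<and> (\<forall>s. g s \<le> 0) \<and> mono g"
proof -
  \<comment> \<open>The infimum of the slopes to the right of \<open>s\<close>, that is, the right
    derivative.\<close>
  define g where "g s = Inf ((\<lambda>t. (\<phi> s - \<phi> t) / (s - t)) ` ({s<..} \<inter> UNIV))" for s
  have g: "\<phi> s + g s * (w - s) \<le> \<phi> w" for s w
    unfolding g_def by (rule convex_le_Inf_differential[OF assms(1)]) auto
  have "g s \<le> 0" for s
    using g[of s "s + 1"] antimonoD[OF assms(2), of s "s + 1"] by simp
  moreover have "g s \<le> g w" if "s \<le> w" for s w
  proof (cases "s = w")
    case False
    have "0 \<le> (g w - g s) * (w - s)"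
      using g[of s w] g[of w s] by (simp add: algebra_simps)
    then show ?thesis
      using False that by (simp add: zero_le_mult_iff)
  qed simp
  ultimately show ?thesis
    using g by (intro exI[of _ g]) (simp add: monoI)
qed

lemma weakly_supermajorized_of_minimiser:
  fixes x y a b :: "real ^ 'n"
  assumes f: "submodular f" and a: "\<And>i. 0 < a $ i" and x: "x \<in> base_polyhedron f"
    and min: "\<And>y. y \<in> base_polyhedron f \<Longrightarrow>
      (\<Sum>k\<in>UNIV. (x $ k + b $ k)\<^sup>2 / a $ k) \<le> (\<Sum>k\<in>UNIV. (y $ k + b $ k)\<^sup>2 / a $ k)"
    and y: "y \<in> submodular_polyhedron f"
  shows "weakly_supermajorized a b x y"
  unfolding weakly_supermajorized_def
proof (intro allI impI)
  fix \<phi> :: "real \<Rightarrow> real"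
  assume "antimono \<phi> \<and> continuous_on UNIV \<phi> \<and> convex_on UNIV \<phi>"
  then have "convex_on UNIV \<phi>" "antimono \<phi>"
    by simp_all
  then obtain g where "(\<forall>s w. \<phi> s + g s * (w - s) \<le> \<phi> w) \<and> (\<forall>s. g s \<le> 0) \<and> mono g"
    using convex_antimono_subgradient by fast
  then have g: "\<And>s w. \<phi> s + g s * (w - s) \<le> \<phi> w" "\<And>s. g s \<le> 0" "mono g"
    by simp_all
  define z where "z i = (x $ i + b $ i) / a $ i" for i
  define w where "w i = (y $ i + b $ i) / a $ i" for i
  \<comment> \<open>A larger \<open>c\<close> forces a smaller \<open>z\<close>, so superlevel sets
    of \<open>c\<close> are tight whatever \<open>\<phi>\<close> is. That \<open>c\<close> is
    non-negative allows \<open>y\<close> to have a smaller total than \<open>x\<close>.\<close>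
  define c :: "real ^ 'n" where "c = (\<chi> i. - g (z i))"
  have "0 \<le> (\<Sum>i\<in>UNIV. c $ i * (x - y) $ i)"
  proof (rule inner_nonneg_of_superlevel_sums)
    fix t
    have "coord_sum x {i. t \<le> c $ i} = f {i. t \<le> c $ i}"
    proof (rule tight_of_separated[OF f x])
      fix i j assume "i \<in> {i. t \<le> c $ i}" "j \<notin> {i. t \<le> c $ i}"
      then have "g (z i) < g (z j)"
        by (simp add: c_def)
      then have "z i < z j"
        using monoD[OF g(3), of "z j" "z i"] by (simp add: not_le[symmetric]) blast
      then show "\<exists>A. i \<in> A \<and> j \<notin> A \<and> coord_sum x A = f A"
        unfolding z_def by (rule tight_separation_of_minimiser[OF a x min, rotated])
    qed
    then show "0 \<le> coord_sum (x - y) {i. t \<le> c $ i}"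
      using y by (simp add: submodular_polyhedron_def coord_sum_def sum_subtractf)
  qed (simp add: c_def g(2))
  also have "\<dots> = (\<Sum>i\<in>UNIV. a $ i * (g (z i) * (w i - z i)))"
  proof (intro sum.cong refl)
    fix i
    have "a $ i * (w i - z i) = y $ i - x $ i"
      using a[of i] by (simp add: w_def z_def right_diff_distrib)
    moreover have "c $ i * (x - y) $ i = g (z i) * (y $ i - x $ i)"
      by (simp add: c_def algebra_simps)
    ultimately show "c $ i * (x - y) $ i = a $ i * (g (z i) * (w i - z i))"
      by (metis mult.left_commute)
  qed
  also have "\<dots> \<le> (\<Sum>i\<in>UNIV. a $ i * (\<phi> (w i) - \<phi> (z i)))"
  proof (intro sum_mono mult_left_mono)
    show "g (z i) * (w i - z i) \<le> \<phi> (w i) - \<phi> (z i)" for i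
      using g(1)[of "z i" "w i"] by simp
  qed (simp add: a less_imp_le)
  finally show "(\<Sum>i\<in>UNIV. a $ i * \<phi> ((x $ i + b $ i) / a $ i))
      \<le> (\<Sum>i\<in>UNIV. a $ i * \<phi> ((y $ i + b $ i) / a $ i))"
    by (simp add: w_def z_def right_diff_distrib sum_subtractf)
qed

lemma base_polyhedron_support_imp_least:
  fixes C :: "(real ^ 'n) set" and a b :: "real ^ 'n"
  assumes "compact C" and f: "submodular (support_max C)"
    and base: "base_polyhedron (support_max C) \<subseteq> C" and P: "C \<subseteq> submodular_polyhedron (support_max C)"
    and a: "\<forall>i. 0 < a $ i"
  shows "\<exists>x. least_weakly_supermajorized C a b x"
proof -
  let ?B = "base_polyhedron (support_max C)"
  \<comment> \<open>For empty \<open>C\<close>, \<open>support_max C\<close> is a constant, which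
    submodularity forces to be 0; then the zero vector lies in \<open>?B\<close>, hence in
    \<open>C\<close>.\<close>
  have "C \<noteq> {}"
  proof
    assume "C = {}"
    then have const: "support_max C A = support_max C {}" for A
      by (simp add: support_max_def)
    have zero: "support_max C {} = 0"
      using f by (simp add: submodular_def)
    have "support_max C A = 0" for A
      using const[of A] zero by (rule trans)
    then have "0 \<in> ?B"
      by (simp add: base_polyhedron_def submodular_polyhedron_def coord_sum_def)
    then show False
      using base \<open>C = {}\<close> by blast
  qed
  then obtain u where "u \<in> C" "coord_sum u UNIV = support_max C UNIV"
    using support_max_attained[OF \<open>compact C\<close>, of UNIV] by blast
  then have "?B \<noteq> {}"
    using P by (auto simp: base_polyhedron_def)
  \<comment> \<open>As the part of \<open>C\<close> on a hyperplane, \<open>?B\<close> inherits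
    compactness, so the quadratic attains its minimum there.\<close>
  have "?B = C \<inter> {x. coord_sum x UNIV = support_max C UNIV}"
    using base P by (auto simp: base_polyhedron_def)
  moreover have "closed {x :: real ^ 'n. coord_sum x UNIV = support_max C UNIV}"
    unfolding coord_sum_def by (intro closed_Collect_eq continuous_intros)
  ultimately have "compact ?B"
    using \<open>compact C\<close> by (simp add: compact_Int_closed)
  have "continuous_on ?B (\<lambda>x. \<Sum>k\<in>UNIV. (x $ k + b $ k)\<^sup>2 / a $ k)"
    using a by (intro continuous_intros) (simp add: less_imp_neq[symmetric])
  then obtain x where x: "x \<in> ?B" and "\<And>y. y \<in> ?B \<Longrightarrow>
      (\<Sum>k\<in>UNIV. (x $ k + b $ k)\<^sup>2 / a $ k) \<le> (\<Sum>k\<in>UNIV. (y $ k + b $ k)\<^sup>2 / a $ k)"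
    using continuous_attains_inf[OF \<open>compact ?B\<close> \<open>?B \<noteq> {}\<close>, of "\<lambda>x. \<Sum>k\<in>UNIV. (x $ k + b $ k)\<^sup>2 / a $ k"]
    by blast
  then have "weakly_supermajorized a b x y" if "y \<in> C" for y
    using subsetD[OF P that] a by (intro weakly_supermajorized_of_minimiser[OF f]) simp_all
  then show ?thesis
    using x base by (auto simp: least_weakly_supermajorized_def)
qed

section \<open>The cycle of implications\<close>

theorem theorem1:
  fixes C :: "(real ^ 'n) set"
  assumes "compact C" and "convex C"
  defines "S1 \<equiv> (\<forall>a b. (\<forall>i. 0 < a $ i) \<longrightarrow> (\<exists>x. least_weakly_supermajorized C a b x))"
    and "S2 \<equiv> (\<forall>b. \<exists>x. least_weakly_supermajorized C 1 b x)"
    and "S3 \<equiv> (\<forall>b. \<exists>xs\<in>C. \<forall>\<Phi>. antimono \<Phi> \<and> continuous_on UNIV \<Phi> \<and> Schur_convex \<Phi> \<longrightarrow>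
                 (\<forall>x\<in>C. \<Phi> (xs + b) \<le> \<Phi> (x + b)))"
    and "S4 \<equiv> (\<forall>\<pi> :: nat \<Rightarrow> 'n. bij_betw \<pi> {1..CARD('n)} UNIV \<longrightarrow>
                 (\<exists>xs\<in>C. \<forall>x\<in>C. \<forall>k\<in>{1..CARD('n)}.
                    (\<Sum>i=1..k. xs $ \<pi> i) \<ge> (\<Sum>i=1..k. x $ \<pi> i)))"
    and "S5 \<equiv> submodular (support_max C) \<and> base_polyhedron (support_max C) \<subseteq> C \<and>
               C \<subseteq> submodular_polyhedron (support_max C)"
  shows "(S1 \<longleftrightarrow> S2) \<and> (S2 \<longleftrightarrow> S3) \<and> (S3 \<longleftrightarrow> S4) \<and> (S4 \<longleftrightarrow> S5)"
proof -
  have "S2" if "S1"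
    using that unfolding S1_def S2_def by (metis one_index zero_less_one)
  moreover have "S3" if "S2"
    unfolding S3_def
  proof
    fix b
    obtain x where "least_weakly_supermajorized C 1 b x"
      using \<open>S2\<close> unfolding S2_def by blast
    then have "x \<in> C" and "\<And>y. y \<in> C \<Longrightarrow> weakly_supermajorized 1 b x y"
      by (simp_all add: least_weakly_supermajorized_def)
    then show "\<exists>xs\<in>C. \<forall>\<Phi>. antimono \<Phi> \<and> continuous_on UNIV \<Phi> \<and> Schur_convex \<Phi> \<longrightarrow>
        (\<forall>x\<in>C. \<Phi> (xs + b) \<le> \<Phi> (x + b))"
      by (intro bexI[of _ x] allI impI ballI weakly_supermajorized_imp_schur_le) simp_all
  qed
  moreover have "S4" if "S3"
    unfolding S4_def
    using schur_minimal_imp_simultaneous_max[OF \<open>compact C\<close> _ that[unfolded S3_def]] by simp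
  moreover have "S5" if "S4"
    unfolding S5_def
  proof (intro conjI)
    show "submodular (support_max C)"
      using \<open>compact C\<close> that[unfolded S4_def] by (rule simultaneous_max_imp_submodular)
    show "base_polyhedron (support_max C) \<subseteq> C"
      using \<open>compact C\<close> \<open>convex C\<close> that[unfolded S4_def] by (rule simultaneous_max_imp_base_subset)
    show "C \<subseteq> submodular_polyhedron (support_max C)"
      using coord_sum_le_support_max[OF \<open>compact C\<close>] by (auto simp: submodular_polyhedron_def)
  qed
  moreover have "S1" if "S5"
    unfolding S1_def
    using that base_polyhedron_support_imp_least[OF \<open>compact C\<close>] unfolding S5_def by simp
  ultimately show ?thesis
    by argo
qed

end
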